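(* Let $L$ be a left Leibniz algebra over a field $F$ which is not a Lie algebra, and suppose that every subalgebra of $L$ is either an ideal of $L$ or self-idealizing in $L$. Let $A=\mathrm{Ln}(L)$ be the locally nilpotent radical of $L$ and suppose that $A$ is abelian. If $A$ is not cyclic, then the following conditions hold: (i) $A=\zeta^{left}(L)$; (ii) $L=A\oplus W$ (direct sum of vector spaces) where $W$ is a subalgebra of $L$ of dimension $1$, $W=Fw$, and $W=\mathrm{I}_{L}(W)$; (iii) there exists a non-zero element $\sigma\in F$ such that $[w,a]=\sigma a$ for every element $a\in A$. Conversely, if a left Leibniz algebra $L$ over $F$ (not a Lie algebra) satisfies conditions (i), (ii), (iii) (for some $A$, $W=Fw$ and $\sigma$), then every subalgebra of $L$ is an ideal of $L$ or self-idealizing in $L$.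
   Context: A left Leibniz algebra over $F$ is an $F$-vector space $L$ (of arbitrary dimension) with a bilinear bracket satisfying $[[a,b],c]=[a,[b,c]]-[b,[a,c]]$ for all $a,b,c\in L$. It is a Lie algebra iff $[a,a]=0$ for all $a\in L$. Ideals are two-sided. An algebra is abelian if $[x,y]=0$ for all $x,y$ in it, and cyclic if it is generated as an algebra by one element. For a subalgebra $S$ of $L$, the idealizer is $\mathrm{I}_L(S)=\{x\in L \mid [x,s],[s,x]\in S \text{ for all } s\in S\}$; $S$ is self-idealizing in $L$ if $S=\mathrm{I}_L(S)$. The left center is $\zeta^{left}(L)=\{x\in L\mid [x,y]=0 \text{ for all } y\in L\}$. An algebra is locally nilpotent if every finitely generated subalgebra is nilpotent. Every Leibniz algebra $L$ has a greatest locally nilpotent ideal, called the locally nilpotent radical and denoted $\mathrm{Ln}(L)$. *)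

theory Defs
  imports Complex_Main
begin

locale leibniz_algebra = vector_space scale
  for scale :: "'k::field \<Rightarrow> 'a::ab_group_add \<Rightarrow> 'a" +
  fixes bracket :: "'a \<Rightarrow> 'a \<Rightarrow> 'a"
  assumes bracket_add_left: "bracket (x + y) z = bracket x z + bracket y z"
    and bracket_add_right: "bracket x (y + z) = bracket x y + bracket x z"
    and bracket_scale_left: "bracket (scale c x) y = scale c (bracket x y)"
    and bracket_scale_right: "bracket x (scale c y) = scale c (bracket x y)"
    and leibniz: "bracket (bracket x y) z = bracket x (bracket y z) - bracket y (bracket x z)"
begin

definition is_lie :: bool where
  "is_lie \<longleftrightarrow> (\<forall>a. bracket a a = 0)"

definition subalgebra :: "'a set \<Rightarrow> bool" where
  "subalgebra S \<longleftrightarrow> subspace S \<and> (\<forall>x\<in>S. \<forall>y\<in>S. bracket x y \<in> S)"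

definition ideal :: "'a set \<Rightarrow> bool" where
  "ideal I \<longleftrightarrow> subspace I \<and> (\<forall>x\<in>I. \<forall>y. bracket x y \<in> I \<and> bracket y x \<in> I)"

definition abelian :: "'a set \<Rightarrow> bool" where
  "abelian S \<longleftrightarrow> (\<forall>x\<in>S. \<forall>y\<in>S. bracket x y = 0)"

definition generated_subalgebra :: "'a set \<Rightarrow> 'a set" where
  "generated_subalgebra X = subalgebra hull X"

definition cyclic :: "'a set \<Rightarrow> bool" where
  "cyclic S \<longleftrightarrow> (\<exists>a. S = generated_subalgebra {a})"

definition idealizer :: "'a set \<Rightarrow> 'a set" where
  "idealizer S = {x. \<forall>s\<in>S. bracket x s \<in> S \<and> bracket s x \<in> S}"

definition self_idealizing :: "'a set \<Rightarrow> bool" where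
  "self_idealizing S \<longleftrightarrow> S = idealizer S"

definition left_center :: "'a set" where
  "left_center = {x. \<forall>y. bracket x y = 0}"

text \<open>Left multiplications suffice here: by the Leibniz identity, every product of \<open>n + 1\<close>
  elements of a subalgebra \<open>S\<close>, however bracketed, lies in \<open>lower_central S n\<close>. The index
  is shifted: \<open>lower_central S n\<close> is the term usually written with index \<open>n + 1\<close>.\<close>

primrec lower_central :: "'a set \<Rightarrow> nat \<Rightarrow> 'a set" where
  "lower_central S 0 = S"
| "lower_central S (Suc n) = span {bracket x y |x y. x \<in> S \<and> y \<in> lower_central S n}"

definition nilpotent :: "'a set \<Rightarrow> bool" where
  "nilpotent S \<longleftrightarrow> (\<exists>n. lower_central S n = {0})"

definition locally_nilpotent :: "'a set \<Rightarrow> bool" where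
  "locally_nilpotent S \<longleftrightarrow>
    (\<forall>X. finite X \<and> X \<subseteq> S \<longrightarrow> nilpotent (generated_subalgebra X))"

text \<open>The locally nilpotent radical as a predicate: being the greatest locally nilpotent
  ideal determines the set uniquely.\<close>

definition is_Ln :: "'a set \<Rightarrow> bool" where
  "is_Ln A \<longleftrightarrow> ideal A \<and> locally_nilpotent A \<and>
    (\<forall>I. ideal I \<and> locally_nilpotent I \<longrightarrow> I \<subseteq> A)"

lemma is_Ln_unique: "is_Ln A \<Longrightarrow> is_Ln B \<Longrightarrow> A = B"
  unfolding is_Ln_def by blast

definition is_direct_sum :: "'a set \<Rightarrow> 'a set \<Rightarrow> bool" where
  "is_direct_sum A W \<longleftrightarrow> subspace A \<and> subspace W \<and>
    A \<inter> W = {0} \<and> (\<forall>x. \<exists>a\<in>A. \<exists>w\<in>W. x = a + w)"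

definition structure_conditions :: "'a set \<Rightarrow> bool" where
  "structure_conditions A \<longleftrightarrow>
    A = left_center \<and>
    (\<exists>W w. is_direct_sum A W \<and> subalgebra W \<and> dim W = 1 \<and> W = span {w} \<and> W = idealizer W \<and>
      (\<exists>\<sigma>. \<sigma> \<noteq> 0 \<and> (\<forall>a\<in>A. bracket w a = scale \<sigma> a)))"

definition every_subalgebra_ideal_or_self_idealizing :: bool where
  "every_subalgebra_ideal_or_self_idealizing \<longleftrightarrow>
    (\<forall>S. subalgebra S \<longrightarrow> ideal S \<or> self_idealizing S)"

end

end

theory Submission
  imports Defs
begin

text \<open>Every subspace of the abelian radical \<open>A\<close> is idealized by \<open>A\<close>, hence is an ideal of \<open>L\<close>.
  Therefore all left and right multiplications act on \<open>A\<close> as scalars. Squares lie in the left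
  center, which is an abelian ideal and so lies in \<open>A\<close>; as some square is non-zero, right
  multiplications vanish on \<open>A\<close>. If \<open>x \<notin> A\<close> annihilated \<open>A\<close>, then the span of \<open>x\<close> and
  \<open>[x,x]\<close> would be a nilpotent subalgebra idealized by \<open>A\<close> but not containing it (\<open>A\<close> is not
  cyclic), hence an ideal, hence contained in \<open>A\<close>. So \<open>L/A\<close> embeds into \<open>F\<close> via the scalar by
  which \<open>x\<close> acts on \<open>A\<close>.\<close>

section \<open>Linear algebra: maps preserving every line of a subspace\<close>

lemma (in vector_space) in_span_singleton: "x \<in> span {a} \<longleftrightarrow> (\<exists>c. x = c *s a)"
  by (auto simp: span_singleton)

text \<open>For independent \<open>a\<close> and \<open>b\<close>, the sum \<open>a + b\<close> is
  an eigenvector too, and comparing coefficients shows that all three eigenvalues agree. It is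
  applied to left and to right multiplications on \<open>A\<close>.\<close>

lemma (in vector_space) scalar_on_subspace_if_eigenvectors:
  assumes A: "subspace A"
    and add: "\<And>x y. f (x + y) = f x + f y"
    and scl: "\<And>c x. f (c *s x) = c *s f x"
    and eig: "\<And>a. a \<in> A \<Longrightarrow> f a \<in> span {a}"
  shows "\<exists>c. \<forall>a\<in>A. f a = c *s a"
proof (cases "A \<subseteq> {0}")
  case True
  have "f 0 = 0" using scl[of 0 0] by simp
  with True have "\<forall>a\<in>A. f a = 0 *s a" by auto
  then show ?thesis ..
next
  case False
  then obtain b where b: "b \<in> A" "b \<noteq> 0" by auto
  obtain c where c: "f b = c *s b" using eig[OF b(1)] by (auto simp: in_span_singleton)
  have "f a = c *s a" if a: "a \<in> A" for a
  proof (cases "a \<in> span {b}")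
    case True
    then show ?thesis by (auto simp: in_span_singleton scl c mult.commute)
  next
    case False
    obtain e where e: "f a = e *s a" using eig[OF a] by (auto simp: in_span_singleton)
    have "a + b \<in> A" using A a b by (simp add: subspace_add)
    then obtain g where g: "f (a + b) = g *s (a + b)"
      using eig by (auto simp: in_span_singleton)
    have eq: "(e - g) *s a = (g - c) *s b"
      using g by (simp add: add e c algebra_simps)
    have eg: "e = g"
    proof (rule ccontr)
      assume "e \<noteq> g"
      then have "a = inverse (e - g) *s ((e - g) *s a)" by simp
      then have "a = (inverse (e - g) * (g - c)) *s b" using eq by simp
      with False show False by (auto simp: in_span_singleton)
    qed
    with eq b have "g = c" by simp
    with e eg show ?thesis by simp
  qed
  then show ?thesis by blast
qed

context leibniz_algebra
begin

section \<open>Bracket identities, the left center and generated subalgebras\<close>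

lemma bracket_zero_left [simp]: "bracket 0 x = 0"
  using bracket_scale_left[of 0 0 x] by simp

lemma bracket_zero_right [simp]: "bracket x 0 = 0"
  using bracket_scale_right[of x 0 0] by simp

lemma bracket_diff_right: "bracket x (y - z) = bracket x y - bracket x z"
  using bracket_add_right[of x "y - z" z] by (simp add: algebra_simps)

lemma bracket_diff_left: "bracket (x - y) z = bracket x z - bracket y z"
  using bracket_add_left[of "x - y" y z] by (simp add: algebra_simps)

text \<open>With equal inner factors the two terms of the Leibniz identity cancel.\<close>

lemma square_in_left_center: "bracket x x \<in> left_center"
  by (simp add: left_center_def leibniz)

text \<open>For left-central \<open>x\<close>, the Leibniz expansion of
  \<open>bracket (bracket y x) z\<close> has two terms, each containing a bracket with left factor
  \<open>x\<close>.\<close>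

lemma ideal_left_center: "ideal left_center"
  unfolding ideal_def subspace_def left_center_def
  by (auto simp: bracket_add_left bracket_scale_left leibniz)

lemma subalgebra_if_ideal: "ideal I \<Longrightarrow> subalgebra I"
  by (auto simp: ideal_def subalgebra_def)

lemma subalgebra_subspace_of_abelian:
  "abelian A \<Longrightarrow> subspace S \<Longrightarrow> S \<subseteq> A \<Longrightarrow> subalgebra S"
  unfolding subalgebra_def abelian_def
  using subspace_0[of S] by (metis subsetD)

lemma subalgebra_generated: "subalgebra (generated_subalgebra X)"
  unfolding generated_subalgebra_def
  by (rule hull_in) (auto simp: subalgebra_def intro!: subspace_Inter)

lemma generated_subalgebra_minimal:
  "X \<subseteq> S \<Longrightarrow> subalgebra S \<Longrightarrow> generated_subalgebra X \<subseteq> S"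
  unfolding generated_subalgebra_def by (rule hull_minimal)

section \<open>Local nilpotency and the radical\<close>

lemma nilpotent_if_bracket_bracket_eq_0:
  assumes "\<And>x y z. x \<in> S \<Longrightarrow> y \<in> S \<Longrightarrow> z \<in> S \<Longrightarrow> bracket x (bracket y z) = 0"
  shows "nilpotent S"
proof -
  have "bracket x u = 0" if x: "x \<in> S" and u: "u \<in> lower_central S 1" for x u
  proof -
    have "u \<in> span {bracket y z |y z. y \<in> S \<and> z \<in> S}" using u by simp
    then show ?thesis
    proof (induction rule: span_induct_alt)
      case base
      show ?case by simp
    next
      case (step c v w)
      then show ?case
        using assms[OF x] by (auto simp: bracket_add_right bracket_scale_right)
    qed
  qed
  then have "{bracket x y |x y. x \<in> S \<and> y \<in> lower_central S 1} \<subseteq> {0}"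
    by blast
  \<comment> \<open>In the shifted indexing this is the third term of the usual series, the one
    spanned by triple products.\<close>
  then have "lower_central S (Suc 1) \<subseteq> span {0}"
    unfolding lower_central.simps(2)[of S 1] by (rule span_mono)
  then have "lower_central S (Suc 1) = {0}"
    using span_zero by auto
  then show ?thesis unfolding nilpotent_def by blast
qed

text \<open>Vanishing of triple products passes to every subalgebra generated inside
  \<open>S\<close>.\<close>

lemma locally_nilpotent_if_bracket_bracket_eq_0:
  assumes "subalgebra S"
    and "\<And>x y z. x \<in> S \<Longrightarrow> y \<in> S \<Longrightarrow> z \<in> S \<Longrightarrow> bracket x (bracket y z) = 0"
  shows "locally_nilpotent S"
  unfolding locally_nilpotent_def
proof (intro allI impI)
  fix X assume "finite X \<and> X \<subseteq> S"
  then have "generated_subalgebra X \<subseteq> S"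
    using assms(1) by (simp add: generated_subalgebra_minimal)
  then show "nilpotent (generated_subalgebra X)"
    by (intro nilpotent_if_bracket_bracket_eq_0 assms(2)) auto
qed

lemma left_center_subset_Ln:
  assumes "is_Ln A"
  shows "left_center \<subseteq> A"
proof -
  have "locally_nilpotent left_center"
    using ideal_left_center
    by (intro locally_nilpotent_if_bracket_bracket_eq_0 subalgebra_if_ideal)
      (auto simp: left_center_def)
  then show ?thesis using assms ideal_left_center by (auto simp: is_Ln_def)
qed

text \<open>Inside an abelian algebra every subspace is a subalgebra, so one element generates just
  its span. Contrapositively, a non-cyclic abelian \<open>A\<close> is not spanned by one
  element.\<close>

lemma cyclic_if_eq_span_singleton:
  assumes "abelian A" "A = span {a}"
  shows "cyclic A"
proof -
  have "subalgebra A"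
    using assms by (intro subalgebra_subspace_of_abelian[of A]) auto
  then have "generated_subalgebra {a} \<subseteq> A"
    using assms by (intro generated_subalgebra_minimal) (auto intro: span_base)
  moreover have "A \<subseteq> generated_subalgebra {a}"
    unfolding assms(2)
    using subalgebra_generated[of "{a}"]
    by (intro span_minimal) (auto simp: subalgebra_def generated_subalgebra_def hull_inc)
  ultimately show ?thesis unfolding cyclic_def by blast
qed

lemma span_element_and_square:
  "u \<in> span {x, bracket x x} \<longleftrightarrow> (\<exists>c d. u = scale c x + scale d (bracket x x))"
  by (auto simp: span_insert in_span_singleton algebra_simps)

section \<open>The subalgebra condition implies the structure conditions\<close>

lemma structure_conditions_if_every_subalgebra:
  assumes not_lie: "\<not> is_lie"
    and every: "every_subalgebra_ideal_or_self_idealizing"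
    and Ln: "is_Ln A" and ab: "abelian A" and nc: "\<not> cyclic A"
  shows "structure_conditions A"
proof -
  have A_ideal: "ideal A" and A_sub: "subspace A"
    using Ln by (auto simp: is_Ln_def ideal_def)
  have subspace_ideal: "ideal S" if S: "subspace S" "S \<subseteq> A" for S
  proof (cases "S = A")
    case False
    have "A \<subseteq> idealizer S"
      using ab S subspace_0[of S] by (auto simp: idealizer_def abelian_def subset_iff)
    with False S have "\<not> self_idealizing S" by (auto simp: self_idealizing_def)
    then show ?thesis
      using every subalgebra_subspace_of_abelian[OF ab S]
      by (auto simp: every_subalgebra_ideal_or_self_idealizing_def)
  qed (use A_ideal in simp)
  have span_ideal: "ideal (span {a})" if "a \<in> A" for a
    using that A_sub by (intro subspace_ideal subspace_span span_minimal) auto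
  have left_scalar: "\<exists>c. \<forall>a\<in>A. bracket x a = scale c a" for x
    using span_ideal
    by (intro scalar_on_subspace_if_eigenvectors A_sub)
      (auto simp: bracket_add_right bracket_scale_right ideal_def intro: span_base)
  have right_scalar: "\<exists>c. \<forall>a\<in>A. bracket a x = scale c a" for x
    using span_ideal
    by (intro scalar_on_subspace_if_eigenvectors[where f = "\<lambda>a. bracket a x"] A_sub)
      (auto simp: bracket_add_left bracket_scale_left ideal_def intro: span_base)
  have square_A: "bracket x x \<in> A" for x
    using square_in_left_center left_center_subset_Ln[OF Ln] by blast
  obtain z where z: "bracket z z \<noteq> 0" using not_lie by (auto simp: is_lie_def)
  have right_zero: "bracket a x = 0" if a: "a \<in> A" for a x
  proof -
    obtain c where c: "\<forall>a\<in>A. bracket a x = scale c a" using right_scalar by blast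
    \<comment> \<open>The non-zero vector \<open>bracket z z\<close> of \<open>A\<close> serves to
      read off the common scalar \<open>c\<close>.\<close>
    have "bracket (bracket z z) x = 0"
      using square_in_left_center[of z] by (simp only: left_center_def mem_Collect_eq)
    then have "scale c (bracket z z) = 0"
      using bspec[OF c square_A[of z]] by (simp only:)
    with z have "c = 0" by simp
    with c a show ?thesis by simp
  qed
  have center: "A = left_center"
    using left_center_subset_Ln[OF Ln] right_zero by (auto simp: left_center_def)
  have annihilator: "x \<in> A" if x: "\<And>a. a \<in> A \<Longrightarrow> bracket x a = 0" for x
  proof (rule ccontr)
    assume xA: "x \<notin> A"
    define T where "T = span {x, bracket x x}"
    have in_T: "u \<in> T \<longleftrightarrow> (\<exists>c d. u = scale c x + scale d (bracket x x))" for u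
      unfolding T_def by (rule span_element_and_square)
    \<comment> \<open>Since \<open>x\<close> and \<open>A\<close> annihilate each other, every
      product in \<open>T\<close> is a multiple of \<open>bracket x x\<close>, and such multiples
      are killed from the left by \<open>T\<close>. This gives both closure and nilpotency of
      \<open>T\<close>.\<close>
    have T_prod: "bracket u v \<in> T \<and> bracket u v \<in> A \<and> (\<forall>t\<in>T. bracket t (bracket u v) = 0)"
      if u: "u \<in> T" and v: "v \<in> T" for u v
    proof -
      obtain c d c' d' where uv: "u = scale c x + scale d (bracket x x)"
        "v = scale c' x + scale d' (bracket x x)" using u v in_T by blast
      have e: "bracket u v = scale (c * c') (bracket x x)"
        using x[OF square_A] right_zero[OF square_A]
        by (simp add: uv bracket_add_left bracket_add_right bracket_scale_left
            bracket_scale_right)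
      have "bracket u v \<in> T"
        unfolding e T_def by (intro span_scale span_base) simp
      moreover have inA: "bracket u v \<in> A"
        unfolding e using A_sub square_A by (simp add: subspace_scale)
      moreover have "bracket t (bracket u v) = 0" if "t \<in> T" for t
        using that x[OF inA] right_zero[OF square_A]
        by (auto simp: in_T bracket_add_left bracket_scale_left)
      ultimately show ?thesis by blast
    qed
    have T_sub: "subalgebra T"
      using T_prod by (simp add: subalgebra_def) (simp add: T_def)
    have "\<not> self_idealizing T"
    proof
      assume "self_idealizing T"
      moreover have "A \<subseteq> idealizer T"
      proof
        fix a assume a: "a \<in> A"
        have "bracket t a = 0" if "t \<in> T" for t
          using that x[OF a] right_zero[OF square_A]
          by (auto simp: in_T bracket_add_left bracket_scale_left)
        then show "a \<in> idealizer T"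
          using right_zero[OF a] by (simp add: idealizer_def T_def span_zero)
      qed
      ultimately have AT: "A \<subseteq> T" by (simp add: self_idealizing_def)
      \<comment> \<open>An element of \<open>A\<close> with non-zero \<open>x\<close>-coefficient
        would put \<open>x\<close> into \<open>A\<close>; so only multiples of
        \<open>bracket x x\<close> remain, and \<open>A\<close> would be cyclic.\<close>
      have "A \<subseteq> span {bracket x x}"
      proof
        fix a assume a: "a \<in> A"
        then obtain c d where cd: "a = scale c x + scale d (bracket x x)"
          using AT in_T by blast
        have "a - scale d (bracket x x) \<in> A"
          using a A_sub square_A by (simp add: subspace_diff subspace_scale)
        then have "scale c x \<in> A" by (simp add: cd)
        then have "scale (inverse c) (scale c x) \<in> A" using A_sub subspace_scale by blast
        with xA have "c = 0" by (cases "c = 0") auto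
        with cd show "a \<in> span {bracket x x}" by (auto simp: in_span_singleton)
      qed
      moreover have "span {bracket x x} \<subseteq> A"
        using A_sub square_A by (intro span_minimal) auto
      ultimately show False
        using nc ab cyclic_if_eq_span_singleton by blast
    qed
    with every T_sub have "ideal T"
      by (auto simp: every_subalgebra_ideal_or_self_idealizing_def)
    moreover have "locally_nilpotent T"
      using T_sub T_prod by (intro locally_nilpotent_if_bracket_bracket_eq_0) auto
    ultimately have "T \<subseteq> A" using Ln by (simp add: is_Ln_def)
    moreover have "x \<in> T" unfolding T_def by (intro span_base) simp
    ultimately show False using xA by blast
  qed
  have zA: "z \<notin> A" using right_zero z by blast
  obtain \<sigma> where \<sigma>: "\<And>a. a \<in> A \<Longrightarrow> bracket z a = scale \<sigma> a" using left_scalar by blast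
  have "\<sigma> \<noteq> 0" using annihilator[of z] zA \<sigma> by auto
  \<comment> \<open>Correcting \<open>z\<close> by an element of \<open>A\<close> kills its square without changing its action on \<open>A\<close>.\<close>
  define w where "w = z - scale (inverse \<sigma>) (bracket z z)"
  have shift_A: "scale (inverse \<sigma>) (bracket z z) \<in> A"
    using A_sub square_A by (simp add: subspace_scale)
  have w_act: "bracket w a = scale \<sigma> a" if "a \<in> A" for a
    using that \<sigma> right_zero[OF shift_A] by (simp add: w_def bracket_diff_left)
  have wA: "w \<notin> A"
  proof
    assume "w \<in> A"
    then have "w + scale (inverse \<sigma>) (bracket z z) \<in> A"
      using shift_A A_sub subspace_add by blast
    with zA show False by (simp add: w_def)
  qed
  have w0: "w \<noteq> 0" using wA A_sub subspace_0 by blast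
  have ww: "bracket w w = 0"
  proof -
    have "bracket w w = bracket w z - scale \<sigma> (scale (inverse \<sigma>) (bracket z z))"
      using w_act[OF shift_A] bracket_diff_right[of w z] by (simp add: w_def)
    also have "bracket w z = bracket z z"
      using right_zero[OF shift_A] by (simp add: w_def bracket_diff_left)
    finally show ?thesis using \<open>\<sigma> \<noteq> 0\<close> by simp
  qed
  have decomposition: "\<exists>a\<in>A. \<exists>c. x = a + scale c w" for x
  proof -
    obtain \<mu> where l: "\<And>a. a \<in> A \<Longrightarrow> bracket x a = scale \<mu> a" using left_scalar by blast
    \<comment> \<open>The coefficient is chosen so that \<open>x\<close> and the multiple of
      \<open>w\<close> act on \<open>A\<close> by the same scalar; their difference annihilates
      \<open>A\<close>.\<close>
    have "x - scale (\<mu> / \<sigma>) w \<in> A"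
      using l w_act \<open>\<sigma> \<noteq> 0\<close>
      by (intro annihilator) (simp add: bracket_diff_left bracket_scale_left)
    then show ?thesis by (metis diff_add_cancel)
  qed
  have "A \<inter> span {w} \<subseteq> {0}"
  proof
    fix a assume "a \<in> A \<inter> span {w}"
    then obtain c where c: "scale c w \<in> A" "a = scale c w" by (auto simp: in_span_singleton)
    have "scale (inverse c) (scale c w) \<in> A" using c A_sub subspace_scale by blast
    with wA c show "a \<in> {0}" by (cases "c = 0") auto
  qed
  then have "A \<inter> span {w} = {0}"
    using subspace_0[OF A_sub] span_zero by blast
  moreover have "\<exists>a\<in>A. \<exists>v\<in>span {w}. x = a + v" for x
    using decomposition[of x] span_scale[OF span_base[of w "{w}"]] by blast
  ultimately have direct: "is_direct_sum A (span {w})"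
    using A_sub by (simp add: is_direct_sum_def)
  have W_sub: "subalgebra (span {w})"
    by (auto simp: subalgebra_def in_span_singleton bracket_scale_left bracket_scale_right ww)
  have "idealizer (span {w}) \<subseteq> span {w}"
  proof
    fix x assume x: "x \<in> idealizer (span {w})"
    obtain a c where a: "a \<in> A" "x = a + scale c w" using decomposition by blast
    \<comment> \<open>Left multiplication by \<open>w\<close> kills the \<open>w\<close>-component
      of \<open>x\<close> and leaves \<open>scale \<sigma> a\<close>, which then lies in both
      summands.\<close>
    have "bracket w x \<in> span {w}" using x by (simp add: idealizer_def span_base)
    then have "scale \<sigma> a \<in> A \<inter> span {w}"
      using a w_act A_sub by (simp add: bracket_add_right bracket_scale_right ww subspace_scale)
    with \<open>A \<inter> span {w} \<subseteq> {0}\<close> \<open>\<sigma> \<noteq> 0\<close> have "a = 0" by auto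
    with a show "x \<in> span {w}" by (auto simp: in_span_singleton)
  qed
  moreover have "span {w} \<subseteq> idealizer (span {w})"
    using W_sub by (auto simp: subalgebra_def idealizer_def)
  moreover have "dim (span {w}) = 1"
    using w0 dim_span_eq_card_independent[of "{w}"] by simp
  ultimately show ?thesis
    unfolding structure_conditions_def
    using center direct W_sub w_act \<open>\<sigma> \<noteq> 0\<close>
    by (intro conjI exI[of _ "span {w}"] exI[of _ w] exI[of _ \<sigma>]) auto
qed

section \<open>The structure conditions imply the subalgebra condition\<close>

lemma every_subalgebra_if_structure_conditions:
  assumes "structure_conditions A"
  shows "every_subalgebra_ideal_or_self_idealizing"
proof -
  obtain w \<sigma> where direct: "is_direct_sum A (span {w})" and W: "subalgebra (span {w})"
    and \<sigma>: "\<sigma> \<noteq> 0" "\<And>a. a \<in> A \<Longrightarrow> bracket w a = scale \<sigma> a" and center: "A = left_center"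
    using assms unfolding structure_conditions_def by blast
  have left: "bracket a x = 0" if "a \<in> A" for a x
    using that center by (simp add: left_center_def)
  have A_sub: "subspace A" using direct by (simp add: is_direct_sum_def)
  \<comment> \<open>It is a square, hence left-central, and also a product inside the subalgebra
    \<open>span {w}\<close>.\<close>
  have "bracket w w \<in> A \<inter> span {w}"
    using W square_in_left_center by (simp add: center subalgebra_def span_base)
  then have ww: "bracket w w = 0" using direct by (auto simp: is_direct_sum_def)
  have decomposition: "\<exists>a\<in>A. \<exists>c. x = a + scale c w" for x
    using direct unfolding is_direct_sum_def by (metis in_span_singleton)
  \<comment> \<open>This is the full multiplication table: only the \<open>w\<close>-coefficient of
    the left factor and the \<open>A\<close>-component of the right factor enter.\<close>
  have act: "bracket (a + scale c w) (b + scale d w) = scale (c * \<sigma>) b"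
    if "a \<in> A" "b \<in> A" for a b c d
    using that by (simp add: bracket_add_left bracket_add_right bracket_scale_left
        bracket_scale_right left \<sigma> ww)
  have "ideal S \<or> self_idealizing S" if S: "subalgebra S" for S
  proof (cases "S \<subseteq> A")
    \<comment> \<open>Left multiplications act on \<open>A\<close> as scalars and right
      multiplications vanish there, so every subspace of \<open>A\<close> is an ideal.\<close>
    case True
    have sub: "subspace S" using S by (simp add: subalgebra_def)
    have "bracket x s \<in> S" if s: "s \<in> S" for x s
    proof -
      obtain a c where a: "a \<in> A" "x = a + scale c w" using decomposition by blast
      have "bracket x s = scale (c * \<sigma>) s"
        using act[of a s c 0] a s True by auto
      with s sub show ?thesis by (simp add: subspace_scale)
    qed
    with True left sub have "ideal S" by (auto simp: ideal_def subspace_0)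
    then show ?thesis ..
  next
    case False
    have sub: "subspace S" and mult: "\<And>x y. x \<in> S \<Longrightarrow> y \<in> S \<Longrightarrow> bracket x y \<in> S"
      using S by (auto simp: subalgebra_def)
    obtain s where s: "s \<in> S" "s \<notin> A" using False by blast
    obtain a c where a: "a \<in> A" "s = a + scale c w" using decomposition by blast
    have c0: "c \<noteq> 0" using a s by auto
    have unscale: "b \<in> S" if "scale r b \<in> S" "r \<noteq> 0" for r b
      using subspace_scale[OF sub that(1), of "inverse r"] that(2) by simp
    \<comment> \<open>This vector is the square of \<open>s\<close>. It yields the component
      \<open>a\<close>, and then subtracting \<open>a\<close> from \<open>s\<close> yields
      \<open>w\<close>.\<close>
    have "scale (c * \<sigma>) a \<in> S" using mult[OF s(1) s(1)] act a by simp
    then have aS: "a \<in> S" using unscale c0 \<sigma> by simp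
    then have "scale c w \<in> S" using subspace_diff[OF sub s(1) aS] a by simp
    then have wS: "w \<in> S" using unscale c0 by blast
    have "idealizer S \<subseteq> S"
    proof
      fix x assume x: "x \<in> idealizer S"
      obtain b d where b: "b \<in> A" "x = b + scale d w" using decomposition by blast
      \<comment> \<open>With \<open>w\<close> in \<open>S\<close>, this bracket isolates the
        \<open>A\<close>-component \<open>b\<close> of \<open>x\<close> up to the factor
        \<open>\<sigma>\<close>; \<open>w\<close> enters \<open>act\<close> as
        \<open>0 + scale 1 w\<close>.\<close>
      have "bracket w x \<in> S" using x wS by (simp add: idealizer_def)
      then have "scale \<sigma> b \<in> S" using act[of 0 b 1 d] b A_sub by (simp add: subspace_0)
      then have "b \<in> S" using unscale \<sigma> by blast
      then show "x \<in> S" using b wS sub by (simp add: subspace_add subspace_scale)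
    qed
    moreover have "S \<subseteq> idealizer S" using mult by (auto simp: idealizer_def)
    ultimately show ?thesis by (auto simp: self_idealizing_def)
  qed
  then show ?thesis by (simp add: every_subalgebra_ideal_or_self_idealizing_def)
qed

end

theorem theoremA:
  fixes scale :: "'k::field \<Rightarrow> 'a::ab_group_add \<Rightarrow> 'a"
    and bracket :: "'a \<Rightarrow> 'a \<Rightarrow> 'a"
  assumes "leibniz_algebra scale bracket"
    and "\<not> leibniz_algebra.is_lie bracket"
  shows
    "(leibniz_algebra.every_subalgebra_ideal_or_self_idealizing scale bracket \<longrightarrow>
       (\<forall>A. leibniz_algebra.is_Ln scale bracket A \<and> leibniz_algebra.abelian bracket A \<and>
            \<not> leibniz_algebra.cyclic scale bracket A \<longrightarrow>
            leibniz_algebra.structure_conditions scale bracket A)) \<and>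
     ((\<exists>A. leibniz_algebra.structure_conditions scale bracket A) \<longrightarrow>
       leibniz_algebra.every_subalgebra_ideal_or_self_idealizing scale bracket)"
  using leibniz_algebra.structure_conditions_if_every_subalgebra[OF assms]
    leibniz_algebra.every_subalgebra_if_structure_conditions[OF assms(1)]
  by blast

end
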